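(* Let $(M,\rho)$ be a metric space in which every closed and bounded subset is compact, let $Q$ be a probability measure on the Borel sigma-field of $M$, and suppose that the Fréchet function $F(p)=\int_M \rho^2(p,x)\,Q(dx)$ is finite for every $p\in M$. Let $X_1,X_2,\ldots$ be i.i.d. $M$-valued random variables with common distribution $Q$. Let $V=\min_{p\in M}F(p)$ be the Fréchet variation of $Q$, and let $V_n=\min_{p\in M}\frac1n\sum_{j=1}^n\rho^2(X_j,p)$ be the sample Fréchet variation. Then $V_n$ is a strongly consistent estimator of $V$, i.e. $V_n\to V$ almost surely as $n\to\infty$.
   Context: For a probability measure $Q$ on a metric space $(M,\rho)$, the Fréchet function is $F(p)=\int_M\rho^2(p,x)\,Q(dx)$, $p\in M$. The Fréchet variation $V$ of $Q$ is the minimum value attained by $F$ on $M$. Given i.i.d. observations $X_1,\ldots,X_n$ from $Q$, the sample Fréchet function is $F_n(p)=\frac1n\sum_{j=1}^n\rho^2(X_j,p)$ and the sample Fréchet variation $V_n$ is the minimum value attained by $F_n$ on $M$. (When every closed bounded subset of $M$ is compact and the Fréchet function is finite somewhere, these minima are attained.) Uniqueness of the minimizer of $F$ is not assumed. *)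

theory Defs
  imports "HOL-Probability.Probability"
begin

text \<open>The Frechet function is valued in \<open>[0, \<infinity>]\<close>, so that its finiteness is a
  meaningful hypothesis.\<close>

definition frechet_function :: "'a::metric_space measure \<Rightarrow> 'a \<Rightarrow> ennreal" where
  "frechet_function Q p = (\<integral>\<^sup>+ x. ennreal ((dist p x)\<^sup>2) \<partial>Q)"

text \<open>\<open>LEAST\<close> over the range is the minimum, as opposed to the infimum: it is unspecified
  if the minimum is not attained.\<close>

definition frechet_variation :: "'a::metric_space measure \<Rightarrow> ennreal" where
  "frechet_variation Q = (LEAST v. v \<in> range (frechet_function Q))"

text \<open>The sample of size \<open>n\<close> is \<open>x 0, \<dots>, x (n - 1)\<close>. At \<open>n = 0\<close>, which plays no role
  for limits, the sample Frechet function is constantly \<open>0\<close>.\<close>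

definition sample_frechet_function :: "(nat \<Rightarrow> 'a::metric_space) \<Rightarrow> nat \<Rightarrow> 'a \<Rightarrow> real" where
  "sample_frechet_function x n p = (1 / real n) * (\<Sum>j<n. (dist (x j) p)\<^sup>2)"

definition sample_frechet_variation :: "(nat \<Rightarrow> 'a::metric_space) \<Rightarrow> nat \<Rightarrow> real" where
  "sample_frechet_variation x n = (LEAST v. v \<in> range (sample_frechet_function x n))"

lemma frechet_variation_eqI:
  assumes "\<And>q. frechet_function Q p \<le> frechet_function Q q"
  shows "frechet_variation Q = frechet_function Q p"
  unfolding frechet_variation_def using assms by (intro Least_equality) auto

lemma sample_frechet_variation_eqI:
  assumes "\<And>q. sample_frechet_function x n p \<le> sample_frechet_function x n q"
  shows "sample_frechet_variation x n = sample_frechet_function x n p"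
  unfolding sample_frechet_variation_def using assms by (intro Least_equality) auto

end

theory Submission imports Defs begin

text \<open>
  The square root of a Frechet function is the distance, in \<open>L\<^sup>2\<close>, between a constant map and
  a fixed random point. By the triangle inequality in \<open>L\<^sup>2\<close> such a function \<open>g\<close> satisfies
  \<open>\<bar>g p - g q\<bar> \<le> dist p q \<le> g p + g q\<close>; these are the Katetov functions of the metric space
  (\<open>katetov_L2_dist\<close>). The sample Frechet function has this form too, the random point being a
  uniformly chosen element of the sample. Everything geometric is then a statement about
  Katetov functions. The left inequality makes them equicontinuous. The right one makes them
  coercive, with a bound on where a minimizer can lie that depends only on the value at one
  point. Hence, when closed bounded sets are compact, minima are attained, and pointwise
  convergence on a dense set already forces convergence of the minimal values
  (\<open>katetov_tendsto_of_dense\<close>, \<open>katetov_min_tendsto\<close>).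

  It remains to have pointwise convergence almost surely at the points of a countable dense
  set, which is the strong law of large numbers for the integrable variables \<open>(dist q (X j))\<^sup>2\<close>.
  Its core is that the partial sums of an i.i.d. sequence \<open>Y\<close> with negative mean are almost surely
  bounded above (\<open>iid_negative_mean_psum_bdd\<close>). Let \<open>M n\<close> be the maximum of the first
  \<open>n\<close> partial sums (the empty one included) and \<open>M' n\<close> the same for the sequence shifted by one.
  Then \<open>M (n + 1) = max 0 (Y 0 + M' n)\<close>, that is, \<open>M (n + 1) - M' n = max (- M' n) (Y 0)\<close>.
  As \<open>M' n\<close> and \<open>M n\<close> have equal expectations and \<open>M n\<close> increases with \<open>n\<close>, the right-hand
  side has nonnegative expectation. If the sums were unbounded with positive probability, hence
  almost surely by Kolmogorov's 0-1 law, the right-hand side would converge to \<open>Y 0\<close>, dominated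
  by \<open>\<bar>Y 0\<bar>\<close>, and the mean of \<open>Y 0\<close> would be nonnegative. Applied to \<open>Y - m - \<epsilon>\<close> and
  \<open>m - Y - \<epsilon>\<close>, where \<open>m\<close> is the mean of \<open>Y\<close>, this gives the strong law.
\<close>

section \<open>Katetov functions on proper metric spaces\<close>

text \<open>Such a \<open>g\<close> is precisely a choice of distances from the points of the space to one
  additional point (possibly at distance zero from an old one) that is compatible with the
  triangle inequality.\<close>

definition katetov :: "('a::metric_space \<Rightarrow> real) \<Rightarrow> bool" where
  "katetov g \<longleftrightarrow> (\<forall>p q. \<bar>g p - g q\<bar> \<le> dist p q \<and> dist p q \<le> g p + g q)"

lemma katetov_nonneg: "katetov g \<Longrightarrow> 0 \<le> g p"
  unfolding katetov_def by (metis add_nonneg_nonneg add_neg_neg dist_self linorder_not_le)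

lemma katetov_le: "katetov g \<Longrightarrow> g p \<le> g q + dist p q"
  unfolding katetov_def by (metis abs_le_D1 diff_le_eq add.commute)

lemma dist_le_katetov: "katetov g \<Longrightarrow> dist p q \<le> g p + g q"
  by (simp add: katetov_def)

text \<open>Points further than \<open>2 * g p0\<close> from \<open>p0\<close> have values above \<open>g p0\<close>, so it suffices to
  minimize over a closed ball, which is compact.\<close>
lemma katetov_attains_min:
  fixes g :: "'a::metric_space \<Rightarrow> real"
  assumes proper: "\<And>S::'a set. closed S \<Longrightarrow> bounded S \<Longrightarrow> compact S"
    and g: "katetov g"
  shows "\<exists>p. \<forall>q. g p \<le> g q"
proof -
  fix p0 :: 'a
  let ?S = "cball p0 (2 * g p0)"
  have "continuous_on ?S g"
  proof (rule lipschitz_on_continuous_on)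
    show "1-lipschitz_on ?S g"
      using g by (intro lipschitz_onI) (auto simp: katetov_def dist_real_def)
  qed
  moreover have "compact ?S" by (intro proper) auto
  moreover have p0: "p0 \<in> ?S" using katetov_nonneg[OF g] by simp
  ultimately obtain p where p: "p \<in> ?S" "\<And>q. q \<in> ?S \<Longrightarrow> g p \<le> g q"
    using continuous_attains_inf[of ?S g] by blast
  have "g p \<le> g q" for q
  proof (cases "q \<in> ?S")
    case False
    then have "g p0 < g q" using dist_le_katetov[OF g, of p0 q] by simp
    with p(2)[OF p0] show ?thesis by simp
  qed (rule p(2))
  then show ?thesis by blast
qed

text \<open>The balls around a fixed point exhaust the space; each is compact, hence has finite nets of
  every mesh \<open>1 / (m + 1)\<close>.\<close>
lemma proper_space_separable:
  assumes proper: "\<And>S::'a::metric_space set. closed S \<Longrightarrow> bounded S \<Longrightarrow> compact S"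
  obtains D :: "'a::metric_space set" where "countable D" "\<And>p e. 0 < e \<Longrightarrow> \<exists>q\<in>D. dist p q < e"
proof -
  fix p0 :: 'a
  have "\<exists>K. finite K \<and> cball p0 (real k) \<subseteq> (\<Union>x\<in>K. ball x (1 / real (Suc m)))" for k m
    using proper[of "cball p0 (real k)"] unfolding compact_eq_totally_bounded by simp
  then obtain K where K: "\<And>k m. finite (K k m)"
      "\<And>k m. cball p0 (real k) \<subseteq> (\<Union>x\<in>K k m. ball x (1 / real (Suc m)))"
    by metis
  show thesis
  proof
    show "countable (\<Union>k m. K k m)" using K(1) by (intro countable_UN) (auto intro: countable_finite)
    fix p :: 'a and e :: real assume "0 < e"
    then obtain m where m: "1 / real (Suc m) < e" using nat_approx_posE by blast
    obtain k where "dist p0 p \<le> real k" using real_arch_simple by blast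
    then have "p \<in> (\<Union>x\<in>K k m. ball x (1 / real (Suc m)))" using K(2) by (meson mem_cball subsetD)
    then obtain x where "x \<in> K k m" "dist x p < 1 / real (Suc m)" by auto
    with m show "\<exists>q\<in>\<Union>k m. K k m. dist p q < e"
      by (intro bexI[of _ x]) (auto simp: dist_commute simp del: of_nat_Suc)
  qed
qed

text \<open>Katetov functions are 1-Lipschitz, so nearby points of \<open>D\<close> control both \<open>G n p\<close> and \<open>g p\<close>.\<close>
lemma katetov_tendsto_of_dense:
  assumes g: "katetov g" and G: "\<forall>\<^sub>F n in F. katetov (G n)"
    and dense: "\<And>p e. 0 < e \<Longrightarrow> \<exists>q\<in>D. dist p q < e"
    and lim: "\<And>q. q \<in> D \<Longrightarrow> ((\<lambda>n. G n q) \<longlongrightarrow> g q) F"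
  shows "((\<lambda>n. G n p) \<longlongrightarrow> g p) F"
proof (rule tendstoI)
  fix e :: real assume "0 < e"
  then obtain q where q: "q \<in> D" "dist p q < e / 3" using dense[of "e / 3" p] by auto
  have "\<forall>\<^sub>F n in F. dist (G n q) (g q) < e / 3"
    using lim[OF q(1)] \<open>0 < e\<close> by (intro tendstoD) auto
  with G show "\<forall>\<^sub>F n in F. dist (G n p) (g p) < e"
  proof eventually_elim
    case (elim n)
    then have "\<bar>G n p - G n q\<bar> \<le> dist p q" "\<bar>g p - g q\<bar> \<le> dist p q"
      using g by (auto simp: katetov_def)
    with elim(2) q(2) show ?case unfolding dist_real_def by linarith
  qed
qed

text \<open>The minimizers \<open>r n\<close> may wander, but since \<open>dist p (r n) \<le> G n p + G n (r n) \<le> 2 * G n p\<close>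
  they stay in a fixed ball. On a finite net of that ball the convergence is uniform, and the
  Lipschitz property transfers the bound from the net to \<open>r n\<close>.\<close>
lemma katetov_min_tendsto:
  fixes g :: "'a::metric_space \<Rightarrow> real"
  assumes proper: "\<And>S::'a set. closed S \<Longrightarrow> bounded S \<Longrightarrow> compact S"
    and G: "\<forall>\<^sub>F n in F. katetov (G n)"
    and lim: "\<And>p. ((\<lambda>n. G n p) \<longlongrightarrow> g p) F"
    and min_g: "\<And>q. g p \<le> g q"
    and min_G: "\<forall>\<^sub>F n in F. \<forall>q. G n (r n) \<le> G n q"
  shows "((\<lambda>n. G n (r n)) \<longlongrightarrow> g p) F"
proof (rule tendstoI)
  fix e :: real assume e: "0 < e"
  define C where "C = 2 * (g p + 1)"
  have "compact (cball p C)" by (intro proper) auto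
  then obtain K where K: "finite K" "cball p C \<subseteq> (\<Union>x\<in>K. ball x (e / 3))"
    using e unfolding compact_eq_totally_bounded by (meson zero_less_divide_iff zero_less_numeral)
  have "\<forall>\<^sub>F n in F. \<forall>k\<in>K. dist (G n k) (g k) < e / 3"
    using K(1) e by (intro eventually_ball_finite ballI tendstoD[OF lim]) auto
  moreover have "\<forall>\<^sub>F n in F. dist (G n p) (g p) < min e 1"
    using e by (intro tendstoD[OF lim]) auto
  ultimately show "\<forall>\<^sub>F n in F. dist (G n (r n)) (g p) < e"
    using G min_G
  proof eventually_elim
    case (elim n)
    have "dist p (r n) \<le> G n p + G n (r n)" using elim(3) by (rule dist_le_katetov)
    moreover have le: "G n (r n) \<le> G n p" using elim(4) by blast
    moreover have "G n p < g p + 1" using elim(2) by (auto simp: dist_real_def)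
    ultimately have "dist p (r n) \<le> C" by (simp add: C_def)
    then obtain k where k: "k \<in> K" "dist k (r n) < e / 3" using K(2) by fastforce
    have "G n k \<le> G n (r n) + dist k (r n)" using elim(3) by (rule katetov_le)
    moreover have "\<bar>G n k - g k\<bar> < e / 3" using elim(1) k(1) by (auto simp: dist_real_def)
    moreover have "g p \<le> g k" by (rule min_g)
    ultimately have "g p - e < G n (r n)" using k(2) e by linarith
    with le elim(2) show ?case by (auto simp: dist_real_def)
  qed
qed

section \<open>Distances to a random point\<close>

lemma (in prob_space) expectation_le_L2:
  fixes u :: "'a \<Rightarrow> real"
  assumes "u \<in> borel_measurable M" "integrable M (\<lambda>x. (u x)\<^sup>2)"
  shows "expectation u \<le> sqrt (expectation (\<lambda>x. (u x)\<^sup>2))"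
proof -
  have "integrable M u" using assms by (rule square_integrable_imp_integrable)
  then have "0 \<le> expectation (\<lambda>x. (u x)\<^sup>2) - (expectation u)\<^sup>2"
    using variance_positive[of u] variance_eq[of u] assms(2) by simp
  then show ?thesis by (intro real_le_rsqrt) simp
qed

lemma (in prob_space) katetov_L2_dist:
  fixes Y :: "'a \<Rightarrow> 'b::metric_space"
  assumes meas: "\<And>p. (\<lambda>x. dist p (Y x)) \<in> borel_measurable M"
    and sq: "\<And>p. integrable M (\<lambda>x. (dist p (Y x))\<^sup>2)"
  shows "katetov (\<lambda>p. sqrt (expectation (\<lambda>x. (dist p (Y x))\<^sup>2)))"
proof -
  let ?g = "\<lambda>p. sqrt (expectation (\<lambda>x. (dist p (Y x))\<^sup>2))"
  have int: "integrable M (\<lambda>x. dist p (Y x))" for p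
    using meas sq by (rule square_integrable_imp_integrable)
  have le: "expectation (\<lambda>x. dist p (Y x)) \<le> ?g p" for p
    by (rule expectation_le_L2[OF meas sq])
  \<comment> \<open>Minkowski's inequality when one summand is the constant \<open>dist p q\<close>: expand the square and
    bound the mixed term by the \<open>L\<^sup>2\<close> norm.\<close>
  have lip: "?g q \<le> ?g p + dist p q" for p q
  proof -
    let ?d = "dist p q"
    have "expectation (\<lambda>x. (dist q (Y x))\<^sup>2)
        \<le> expectation (\<lambda>x. (dist p (Y x))\<^sup>2 + 2 * ?d * dist p (Y x) + ?d\<^sup>2)"
    proof (rule integral_mono)
      fix x
      have "dist q (Y x) \<le> dist p (Y x) + ?d" by metric
      then have "(dist q (Y x))\<^sup>2 \<le> (dist p (Y x) + ?d)\<^sup>2" by (rule power_mono) simp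
      then show "(dist q (Y x))\<^sup>2 \<le> (dist p (Y x))\<^sup>2 + 2 * ?d * dist p (Y x) + ?d\<^sup>2"
        by (simp add: power2_sum algebra_simps)
    qed (use sq int in auto)
    also have "\<dots> = expectation (\<lambda>x. (dist p (Y x))\<^sup>2) + 2 * ?d * expectation (\<lambda>x. dist p (Y x)) + ?d\<^sup>2"
      using sq int by (simp add: prob_space)
    also have "\<dots> \<le> (?g p)\<^sup>2 + 2 * ?d * ?g p + ?d\<^sup>2"
      using le[of p] by (intro add_mono mult_left_mono) auto
    also have "\<dots> = (?g p + ?d)\<^sup>2" by (simp only: power2_sum) (simp add: algebra_simps)
    finally show ?thesis by (intro real_le_lsqrt) auto
  qed
  have tri: "dist p q \<le> ?g p + ?g q" for p q
  proof -
    have "dist p q = expectation (\<lambda>x. dist p q)" by (simp add: prob_space)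
    also have "\<dots> \<le> expectation (\<lambda>x. dist p (Y x) + dist q (Y x))"
      by (intro integral_mono Bochner_Integration.integrable_add int) (auto intro: dist_triangle2 simp: dist_commute)
    also have "\<dots> \<le> ?g p + ?g q" using int le by (simp add: add_mono)
    finally show ?thesis .
  qed
  have "\<bar>?g p - ?g q\<bar> \<le> dist p q" for p q
    using lip[of p q] lip[of q p] by (simp add: dist_commute abs_le_iff)
  with tri show ?thesis by (auto simp: katetov_def)
qed

section \<open>Maxima of partial sums\<close>

text \<open>The maximum of the sums over the first \<open>k\<close> terms of \<open>y\<close>, for \<open>k\<close> from \<open>0\<close> to \<open>n\<close>. The
  recursion splits off the first term instead of the last because comparing the
  sequence with its shift is what the argument for random sequences rests on.\<close>
primrec max_psum :: "nat \<Rightarrow> (nat \<Rightarrow> real) \<Rightarrow> real" where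
  "max_psum 0 y = 0"
| "max_psum (Suc n) y = max 0 (y 0 + max_psum n (\<lambda>i. y (Suc i)))"

lemma psum_le_max_psum: "k \<le> n \<Longrightarrow> (\<Sum>i<k. y i) \<le> max_psum n y"
proof (induction n arbitrary: k y)
  case (Suc n)
  show ?case
  proof (cases k)
    case (Suc j)
    then have "(\<Sum>i<j. y (Suc i)) \<le> max_psum n (\<lambda>i. y (Suc i))"
      using Suc.prems by (intro Suc.IH) simp
    with Suc show ?thesis by (simp add: sum.lessThan_Suc_shift del: sum.lessThan_Suc)
  qed simp
qed simp

lemma max_psum_attained: "\<exists>k\<le>n. max_psum n y = (\<Sum>i<k. y i)"
proof (induction n arbitrary: y)
  case (Suc n)
  obtain k where "k \<le> n" "max_psum n (\<lambda>i. y (Suc i)) = (\<Sum>i<k. y (Suc i))" using Suc by blast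
  then have "y 0 + max_psum n (\<lambda>i. y (Suc i)) = (\<Sum>i<Suc k. y i)" "Suc k \<le> Suc n"
    by (auto simp: sum.lessThan_Suc_shift simp del: sum.lessThan_Suc)
  then show ?case by (cases "0 \<le> (\<Sum>i<Suc k. y i)") (auto simp: max_def intro: exI[of _ 0])
qed simp

lemma max_psum_nonneg: "0 \<le> max_psum n y"
  by (cases n) auto

lemma max_psum_measurable [measurable]:
  "max_psum n \<in> borel_measurable (PiM UNIV (\<lambda>_. borel))"
proof (induction n)
  case (Suc n)
  note Suc[measurable]
  have [measurable]: "(\<lambda>y i. y (Suc i)) \<in> PiM UNIV (\<lambda>_. borel) \<rightarrow>\<^sub>M PiM UNIV (\<lambda>_. borel :: real measure)"
    by (intro measurable_PiM_single') (auto simp: space_PiM)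
  show ?case unfolding max_psum.simps by measurable
qed simp

text \<open>Dropping the first \<open>k\<close> terms changes all later partial sums by the same constant. This is
  what makes boundedness of the partial sums a tail event.\<close>
lemma bdd_above_psum_shift:
  fixes y :: "nat \<Rightarrow> real"
  shows "bdd_above (range (\<lambda>n. \<Sum>i<n. y (i + k))) \<longleftrightarrow> bdd_above (range (\<lambda>n. \<Sum>i<n. y i))"
proof -
  have split: "(\<Sum>i<n + k. y i) = (\<Sum>i<k. y i) + (\<Sum>i<n. y (i + k))" for n
    by (induction n) (auto simp: algebra_simps)
  show ?thesis
  proof
    assume "bdd_above (range (\<lambda>n. \<Sum>i<n. y i))"
    then obtain B where "\<And>n. (\<Sum>i<n. y i) \<le> B" by (auto simp: bdd_above_def)
    from this[of "_ + k"] have "(\<Sum>i<n. y (i + k)) \<le> B - (\<Sum>i<k. y i)" for n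
      unfolding split by (simp add: algebra_simps)
    then show "bdd_above (range (\<lambda>n. \<Sum>i<n. y (i + k)))" by (auto simp: bdd_above_def)
  next
    assume "bdd_above (range (\<lambda>n. \<Sum>i<n. y (i + k)))"
    then obtain B where B: "\<And>n. (\<Sum>i<n. y (i + k)) \<le> B" by (auto simp: bdd_above_def)
    have "(\<Sum>i<n. y i) \<le> max ((\<Sum>i<k. y i) + B) (Max ((\<lambda>m. \<Sum>i<m. y i) ` {..k}))" for n
    proof (cases "n \<le> k")
      case True
      then have "(\<Sum>i<n. y i) \<le> Max ((\<lambda>m. \<Sum>i<m. y i) ` {..k})" by (intro Max_ge) auto
      then show ?thesis by simp
    next
      case False
      then show ?thesis using split[of "n - k"] B[of "n - k"] by simp
    qed
    then show "bdd_above (range (\<lambda>n. \<Sum>i<n. y i))" by (auto simp: bdd_above_def)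
  qed
qed

lemma max_psum_at_top:
  assumes "\<not> bdd_above (range (\<lambda>n. \<Sum>i<n. y i))"
  shows "\<forall>\<^sub>F n in sequentially. C \<le> max_psum n y"
proof -
  obtain k where k: "C \<le> (\<Sum>i<k. y i)"
    using assms by (metis bdd_above.I2 linear)
  have "C \<le> max_psum n y" if "k \<le> n" for n
    using psum_le_max_psum[OF that, of y] k by linarith
  then show ?thesis by (auto simp: eventually_sequentially)
qed

section \<open>The strong law of large numbers\<close>

lemma (in prob_space) indep_vars_psum_bdd_0_1:
  fixes Y :: "nat \<Rightarrow> 'a \<Rightarrow> real"
  assumes indep: "indep_vars (\<lambda>_. borel) Y UNIV"
  shows "(AE \<omega> in M. bdd_above (range (\<lambda>n. \<Sum>i<n. Y i \<omega>)))
    \<or> (AE \<omega> in M. \<not> bdd_above (range (\<lambda>n. \<Sum>i<n. Y i \<omega>)))"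
proof -
  define A where "A i = sigma_sets (space M) {Y i -` S \<inter> space M | S. S \<in> sets borel}" for i
  define B where "B = {\<omega>\<in>space M. bdd_above (range (\<lambda>n. \<Sum>i<n. Y i \<omega>))}"
  have [measurable]: "Y i \<in> borel_measurable M" for i
    using indep by (simp add: indep_vars_def)
  have "indep_sets A UNIV"
    using indep by (simp add: indep_vars_def A_def[abs_def])
  moreover have "sigma_algebra (space M) (A i)" for i
    unfolding A_def by (intro sigma_algebra_sigma_sets) auto
  moreover have "B \<in> tail_events A"
    unfolding tail_events_def
  proof
    fix k
    let ?G = "\<Union> (A ` {k..})"
    define N where "N = sigma (space M) ?G"
    have G: "?G \<subseteq> Pow (space M)"
      unfolding A_def by (auto dest!: sigma_sets_into_sp[rotated])
    have [simp]: "space N = space M" and sN: "sets N = sigma_sets (space M) ?G"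
      using G by (auto simp: N_def space_measure_of sets_measure_of)
    have [measurable]: "Y (i + k) \<in> borel_measurable N" for i
    proof (rule measurableI)
      fix S :: "real set" assume "S \<in> sets borel"
      then have "Y (i + k) -` S \<inter> space M \<in> A (i + k)"
        unfolding A_def by (intro sigma_sets.Basic) auto
      then show "Y (i + k) -` S \<inter> space N \<in> sets N"
        unfolding sN by (intro sigma_sets.Basic UN_I[of "i + k"]) auto
    qed simp
    \<comment> \<open>\<open>N\<close> is generated by \<open>Y k, Y (k + 1), \<dots>\<close>, so \<open>B\<close> has to be expressed through these alone.\<close>
    have "B = {\<omega>\<in>space N. bdd_above (range (\<lambda>n. \<Sum>i<n. Y (i + k) \<omega>))}"
      unfolding B_def by (simp add: bdd_above_psum_shift[where y = "\<lambda>i. Y i _"])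
    also have "\<dots> = {\<omega>\<in>space N. \<exists>K::nat. \<forall>n. (\<Sum>i<n. Y (i + k) \<omega>) \<le> real K}"
      unfolding bdd_above_def by (auto, meson real_arch_simple order_trans)
    also have "\<dots> \<in> sets N" by measurable
    finally show "B \<in> sigma_sets (space M) ?G" unfolding sN .
  qed
  ultimately have "prob B = 0 \<or> prob B = 1" by (intro kolmogorov_0_1_law)
  moreover have "B = {\<omega>\<in>space M. \<exists>K::nat. \<forall>n. (\<Sum>i<n. Y i \<omega>) \<le> real K}"
    unfolding B_def bdd_above_def by (auto, meson real_arch_simple order_trans)
  then have "B \<in> events" by simp
  ultimately show ?thesis
    by (auto simp: prob_eq_0 prob_eq_1 B_def elim!: AE_mp)
qed

lemma distr_compose_cong:
  assumes f: "f \<in> measurable M N" and g: "g \<in> measurable M N" and h: "h \<in> measurable N L"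
    and eq: "distr M N f = distr M N g"
  shows "distr M L (\<lambda>x. h (f x)) = distr M L (\<lambda>x. h (g x))"
  using distr_distr[OF h f] distr_distr[OF h g] unfolding eq comp_def by (rule trans[OF sym])

text \<open>An i.i.d. sequence is stationary: the joint law is a product of copies of one law, both before
  and after the shift.\<close>
lemma (in prob_space) iid_distr_shift:
  fixes Y :: "nat \<Rightarrow> 'a \<Rightarrow> 'b"
  assumes indep: "indep_vars (\<lambda>_. N) Y UNIV"
    and ident: "\<And>i. distr M N (Y i) = distr M N (Y 0)"
  shows "distr M (PiM UNIV (\<lambda>_. N)) (\<lambda>\<omega> i. Y (Suc i) \<omega>)
    = distr M (PiM UNIV (\<lambda>_. N)) (\<lambda>\<omega> i. Y i \<omega>)"
proof -
  have rv: "random_variable N (Y i)" for i using indep by (simp add: indep_vars_def)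
  have "indep_vars (\<lambda>_. N) (\<lambda>i. Y (Suc i)) UNIV"
  proof -
    \<comment> \<open>Reindexing along \<open>Suc\<close> is grouping into the singleton blocks \<open>{Suc j}\<close>.\<close>
    have "indep_vars (\<lambda>j. PiM {Suc j} (\<lambda>_. N)) (\<lambda>j \<omega>. restrict (\<lambda>i. Y i \<omega>) {Suc j}) UNIV"
      by (rule indep_vars_restrict[OF indep]) (auto simp: disjoint_family_on_def)
    from indep_vars_compose2[OF this, of "\<lambda>j f. f (Suc j)" "\<lambda>_. N"] show ?thesis by simp
  qed
  then have "distr M (PiM UNIV (\<lambda>_. N)) (\<lambda>\<omega> i. Y (Suc i) \<omega>) = PiM UNIV (\<lambda>i. distr M N (Y (Suc i)))"
    using indep_vars_iff_distr_eq_PiM'[where I = UNIV and M' = "\<lambda>_. N" and X = "\<lambda>i. Y (Suc i)"] rv by (simp add: restrict_UNIV)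
  also have "\<dots> = PiM UNIV (\<lambda>i. distr M N (Y i))"
    using ident by metis
  also have "\<dots> = distr M (PiM UNIV (\<lambda>_. N)) (\<lambda>\<omega> i. Y i \<omega>)"
    using indep_vars_iff_distr_eq_PiM'[where I = UNIV and M' = "\<lambda>_. N" and X = Y] rv indep by (simp add: restrict_UNIV)
  finally show ?thesis .
qed

text \<open>By stationarity and \<open>step\<close> below, \<open>max (- ?Z n) (Y 0)\<close> has as expectation the growth from
  \<open>n\<close> to \<open>n + 1\<close> of the expected maximal partial sum, which is nonnegative. If the maxima
  \<open>?Z n\<close> of the shifted sequence tended to infinity, dominated convergence would pass this
  sign on to the mean of \<open>Y 0\<close>.\<close>
lemma (in prob_space) iid_negative_mean_psum_bdd:
  fixes Y :: "nat \<Rightarrow> 'a \<Rightarrow> real"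
  assumes indep: "indep_vars (\<lambda>_. borel) Y UNIV"
    and ident: "\<And>i. distr M borel (Y i) = distr M borel (Y 0)"
    and int: "integrable M (Y 0)"
    and neg: "expectation (Y 0) < 0"
  shows "AE \<omega> in M. bdd_above (range (\<lambda>n. \<Sum>i<n. Y i \<omega>))"
proof (rule ccontr)
  assume "\<not> ?thesis"
  with indep_vars_psum_bdd_0_1[OF indep]
  have unbdd: "AE \<omega> in M. \<not> bdd_above (range (\<lambda>n. \<Sum>i<n. Y i \<omega>))" by blast
  have rv [measurable]: "Y i \<in> borel_measurable M" for i
    using indep by (simp add: indep_vars_def)
  have intY: "integrable M (Y i)" for i
  proof -
    have "integrable (distr M borel (Y 0)) (\<lambda>x. x)"
      using int by (simp add: integrable_distr_eq)
    then have "integrable (distr M borel (Y i)) (\<lambda>x. x)"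
      by (subst ident)
    then show ?thesis by (simp add: integrable_distr_eq)
  qed
  have int_max: "integrable M (\<lambda>\<omega>. max_psum n (\<lambda>i. Y (i + k) \<omega>))" for n k
  proof (induction n arbitrary: k)
    case (Suc n)
    have "integrable M (\<lambda>\<omega>. Y k \<omega> + max_psum n (\<lambda>i. Y (Suc (i + k)) \<omega>))"
      using Suc[of "Suc k"] intY by (intro Bochner_Integration.integrable_add) simp_all
    then have "integrable M (\<lambda>\<omega>. max 0 (Y k \<omega> + max_psum n (\<lambda>i. Y (Suc (i + k)) \<omega>)))"
      by (intro integrable_max) simp_all
    then show ?case by simp
  qed simp
  note int_max0 = int_max[of _ 0, simplified] and int_max1 = int_max[of _ 1, simplified]
  let ?Z = "\<lambda>n \<omega>. max_psum n (\<lambda>i. Y (Suc i) \<omega>)"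
  have same: "expectation (?Z n) = expectation (\<lambda>\<omega>. max_psum n (\<lambda>i. Y i \<omega>))" for n
  proof -
    have "expectation (?Z n)
        = integral\<^sup>L (distr M (PiM UNIV (\<lambda>_. borel)) (\<lambda>\<omega> i. Y (Suc i) \<omega>)) (max_psum n)"
      by (rule integral_distr[symmetric]) (auto intro!: measurable_PiM_single' simp: space_PiM)
    also have "\<dots> = integral\<^sup>L (distr M (PiM UNIV (\<lambda>_. borel)) (\<lambda>\<omega> i. Y i \<omega>)) (max_psum n)"
      by (subst iid_distr_shift[OF indep ident]) (rule refl)
    also have "\<dots> = expectation (\<lambda>\<omega>. max_psum n (\<lambda>i. Y i \<omega>))"
      by (rule integral_distr) (auto intro!: measurable_PiM_single' simp: space_PiM)
    finally show ?thesis .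
  qed
  have step: "max (- ?Z n \<omega>) (Y 0 \<omega>) = max_psum (Suc n) (\<lambda>i. Y i \<omega>) - ?Z n \<omega>" for n \<omega>
    by (simp add: max_def)
  have "0 \<le> expectation (\<lambda>\<omega>. max (- ?Z n \<omega>) (Y 0 \<omega>))" for n
  proof -
    have "expectation (\<lambda>\<omega>. max_psum n (\<lambda>i. Y i \<omega>)) \<le> expectation (\<lambda>\<omega>. max_psum (Suc n) (\<lambda>i. Y i \<omega>))"
    proof (rule integral_mono[OF int_max0 int_max0])
      fix \<omega>
      obtain k where "k \<le> n" "max_psum n (\<lambda>i. Y i \<omega>) = (\<Sum>i<k. Y i \<omega>)"
        using max_psum_attained by blast
      then show "max_psum n (\<lambda>i. Y i \<omega>) \<le> max_psum (Suc n) (\<lambda>i. Y i \<omega>)"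
        using psum_le_max_psum[of k "Suc n" "\<lambda>i. Y i \<omega>"] by simp
    qed
    then show ?thesis
      unfolding step
      by (subst Bochner_Integration.integral_diff[OF int_max0 int_max1]) (simp add: same)
  qed
  moreover have "(\<lambda>n. expectation (\<lambda>\<omega>. max (- ?Z n \<omega>) (Y 0 \<omega>))) \<longlonglongrightarrow> expectation (Y 0)"
  proof (rule integral_dominated_convergence[where w = "\<lambda>\<omega>. \<bar>Y 0 \<omega>\<bar>"])
    show "AE \<omega> in M. (\<lambda>n. max (- ?Z n \<omega>) (Y 0 \<omega>)) \<longlonglongrightarrow> Y 0 \<omega>"
      using unbdd
    proof eventually_elim
      case (elim \<omega>)
      then have "\<not> bdd_above (range (\<lambda>n. \<Sum>i<n. Y (Suc i) \<omega>))"
        using bdd_above_psum_shift[of "\<lambda>i. Y i \<omega>" 1] by simp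
      from max_psum_at_top[OF this, of "- Y 0 \<omega>"]
      have "\<forall>\<^sub>F n in sequentially. max (- ?Z n \<omega>) (Y 0 \<omega>) = Y 0 \<omega>"
        by (rule eventually_mono) simp
      then show ?case by (rule tendsto_eventually)
    qed
    show "AE \<omega> in M. norm (max (- ?Z n \<omega>) (Y 0 \<omega>)) \<le> \<bar>Y 0 \<omega>\<bar>" for n
    proof (rule AE_I2)
      fix \<omega>
      have "0 \<le> ?Z n \<omega>" by (rule max_psum_nonneg)
      then show "norm (max (- ?Z n \<omega>) (Y 0 \<omega>)) \<le> \<bar>Y 0 \<omega>\<bar>" by (simp add: max_def abs_if)
    qed
    show "(\<lambda>\<omega>. max (- ?Z n \<omega>) (Y 0 \<omega>)) \<in> borel_measurable M" for n
      using int_max1[of n] by (intro borel_measurable_max) auto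
  qed (use int in auto)
  ultimately have "0 \<le> expectation (Y 0)" by (intro LIMSEQ_le_const) auto
  with neg show False by simp
qed

text \<open>After subtracting slightly more than the mean, the partial sums are bounded above, and a
  constant bound vanishes when divided by \<open>n\<close>. The excess runs over the countable family
  \<open>d k\<close>, so that one null set serves for all of them.\<close>
lemma (in prob_space) iid_AE_avg_le:
  fixes Y :: "nat \<Rightarrow> 'a \<Rightarrow> real"
  assumes indep: "indep_vars (\<lambda>_. borel) Y UNIV"
    and ident: "\<And>i. distr M borel (Y i) = distr M borel (Y 0)"
    and int: "integrable M (Y 0)"
  shows "AE \<omega> in M. \<forall>e>0. \<forall>\<^sub>F n in sequentially. (\<Sum>i<n. Y i \<omega>) / real n < expectation (Y 0) + e"
proof -
  let ?m = "expectation (Y 0)"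
  define d where "d k = 1 / real (Suc k)" for k
  have "AE \<omega> in M. bdd_above (range (\<lambda>n. \<Sum>i<n. Y i \<omega> - (?m + d k)))" for k
  proof (rule iid_negative_mean_psum_bdd)
    show "indep_vars (\<lambda>_. borel) (\<lambda>i \<omega>. Y i \<omega> - (?m + d k)) UNIV"
      by (rule indep_vars_compose2[OF indep]) simp
    have rv [measurable]: "Y i \<in> borel_measurable M" for i
      using indep by (simp add: indep_vars_def)
    show "distr M borel (\<lambda>\<omega>. Y i \<omega> - (?m + d k)) = distr M borel (\<lambda>\<omega>. Y 0 \<omega> - (?m + d k))" for i
      by (rule distr_compose_cong[OF rv rv _ ident]) simp
  qed (use int in \<open>auto simp: prob_space d_def\<close>)
  then have "AE \<omega> in M. \<forall>k. bdd_above (range (\<lambda>n. \<Sum>i<n. Y i \<omega> - (?m + d k)))"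
    by (simp add: AE_all_countable)
  then show ?thesis
  proof eventually_elim
    case (elim \<omega>)
    show ?case
    proof (intro allI impI)
      fix e :: real assume "0 < e"
      then obtain k where k: "d k < e" using nat_approx_posE unfolding d_def by blast
      from elim obtain B where "\<And>n. (\<Sum>i<n. Y i \<omega> - (?m + d k)) \<le> B"
        unfolding bdd_above_def by (meson rangeI)
      then have B: "(\<Sum>i<n. Y i \<omega>) \<le> B + real n * (?m + d k)" for n
        by (simp add: sum_subtractf algebra_simps)
      have "(\<lambda>n. B / real n) \<longlonglongrightarrow> 0" by (rule lim_const_over_n)
      then have "\<forall>\<^sub>F n in sequentially. B / real n < e - d k"
        using k by (intro order_tendstoD) auto
      with eventually_gt_at_top[of "0::nat"]
      show "\<forall>\<^sub>F n in sequentially. (\<Sum>i<n. Y i \<omega>) / real n < ?m + e"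
      proof eventually_elim
        case (elim n)
        have "(\<Sum>i<n. Y i \<omega>) / real n \<le> (B + real n * (?m + d k)) / real n"
          using B by (intro divide_right_mono) auto
        also have "\<dots> = B / real n + (?m + d k)" using elim(1) by (simp add: add_divide_distrib)
        finally show ?case using elim(2) by simp
      qed
    qed
  qed
qed

text \<open>The upper estimate for \<open>Y\<close> and for \<open>- Y\<close>.\<close>
theorem (in prob_space) strong_law_of_large_numbers:
  fixes Y :: "nat \<Rightarrow> 'a \<Rightarrow> real"
  assumes indep: "indep_vars (\<lambda>_. borel) Y UNIV"
    and ident: "\<And>i. distr M borel (Y i) = distr M borel (Y 0)"
    and int: "integrable M (Y 0)"
  shows "AE \<omega> in M. (\<lambda>n. (\<Sum>i<n. Y i \<omega>) / real n) \<longlonglongrightarrow> expectation (Y 0)"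
proof -
  have "AE \<omega> in M. \<forall>e>0. \<forall>\<^sub>F n in sequentially.
      (\<Sum>i<n. - Y i \<omega>) / real n < expectation (\<lambda>\<omega>. - Y 0 \<omega>) + e"
  proof (rule iid_AE_avg_le)
    show "indep_vars (\<lambda>_. borel) (\<lambda>i \<omega>. - Y i \<omega>) UNIV"
      by (rule indep_vars_compose2[OF indep]) simp
    have rv [measurable]: "Y i \<in> borel_measurable M" for i
      using indep by (simp add: indep_vars_def)
    show "distr M borel (\<lambda>\<omega>. - Y i \<omega>) = distr M borel (\<lambda>\<omega>. - Y 0 \<omega>)" for i
      by (rule distr_compose_cong[OF rv rv _ ident]) simp
  qed (use int in auto)
  with iid_AE_avg_le[OF assms] show ?thesis
  proof eventually_elim
    case (elim \<omega>)
    show ?case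
    proof (rule tendstoI)
      fix e :: real assume "0 < e"
      then have "\<forall>\<^sub>F n in sequentially. (\<Sum>i<n. Y i \<omega>) / real n < expectation (Y 0) + e"
        "\<forall>\<^sub>F n in sequentially. (\<Sum>i<n. - Y i \<omega>) / real n < expectation (\<lambda>\<omega>. - Y 0 \<omega>) + e"
        using elim by blast+
      then show "\<forall>\<^sub>F n in sequentially. dist ((\<Sum>i<n. Y i \<omega>) / real n) (expectation (Y 0)) < e"
        by eventually_elim (auto simp: sum_negf dist_real_def)
    qed
  qed
qed

section \<open>Frechet functions and consistency of the sample variation\<close>

lemma sample_frechet_function_altdef:
  assumes "0 < n"
  shows "sample_frechet_function x n p
    = measure_pmf.expectation (pmf_of_set {..<n}) (\<lambda>j. (dist p (x j))\<^sup>2)"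
proof -
  have "{..<n} \<noteq> {}" using assms by auto
  then show ?thesis
    by (subst integral_pmf_of_set) (simp_all add: sample_frechet_function_def dist_commute)
qed

lemma katetov_sample_frechet:
  assumes "0 < n"
  shows "katetov (\<lambda>p. sqrt (sample_frechet_function x n p))"
proof -
  have "{..<n} \<noteq> {}" using assms by auto
  then show ?thesis
    unfolding sample_frechet_function_altdef[OF assms]
    by (intro measure_pmf.katetov_L2_dist integrable_measure_pmf_finite) simp_all
qed

lemma frechet_function_eq_expectation:
  assumes "sets Q = sets borel" "frechet_function Q p < \<infinity>"
  shows "integrable Q (\<lambda>x. (dist p x)\<^sup>2)"
    and "frechet_function Q p = ennreal (\<integral>x. (dist p x)\<^sup>2 \<partial>Q)"
proof -
  have [measurable]: "(\<lambda>x. (dist p x)\<^sup>2) \<in> borel_measurable Q"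
    by (subst measurable_cong_sets[OF assms(1) refl])
       (intro borel_measurable_continuous_onI continuous_intros)
  show int: "integrable Q (\<lambda>x. (dist p x)\<^sup>2)"
    using assms(2) by (intro integrableI_nonneg) (auto simp: frechet_function_def)
  show "frechet_function Q p = ennreal (\<integral>x. (dist p x)\<^sup>2 \<partial>Q)"
    unfolding frechet_function_def by (rule nn_integral_eq_integral[OF int]) simp
qed

theorem proposition2p4:
  fixes Q :: "'a::metric_space measure"
    and P :: "'w measure"
    and X :: "nat \<Rightarrow> 'w \<Rightarrow> 'a"
  assumes heine_borel: "\<And>S::'a set. closed S \<Longrightarrow> bounded S \<Longrightarrow> compact S"
    and "prob_space Q"
    and "sets Q = sets borel"
    and finite_frechet: "\<And>p. frechet_function Q p < \<infinity>"
    and "prob_space P"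
    and indep: "prob_space.indep_vars P (\<lambda>_. borel) X UNIV"
    and distr: "\<And>j. distr P borel (X j) = Q"
  shows "AE \<omega> in P. (\<lambda>n. sample_frechet_variation (\<lambda>j. X j \<omega>) n)
           \<longlonglongrightarrow> enn2real (frechet_variation Q)"
proof -
  interpret Q: prob_space Q by fact
  interpret P: prob_space P by fact
  have rv [measurable]: "X i \<in> borel_measurable P" for i
    using indep by (simp add: P.indep_vars_def)
  have dist_meas [measurable]: "(\<lambda>x. dist p x) \<in> borel_measurable borel" for p :: 'a
    by (intro borel_measurable_continuous_onI continuous_intros)
  define f where "f p = (\<integral>x. (dist p x)\<^sup>2 \<partial>Q)" for p
  define g where "g p = sqrt (f p)" for p
  define G where "G \<omega> n p = sqrt (sample_frechet_function (\<lambda>j. X j \<omega>) n p)" for \<omega> n p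
  have int: "integrable Q (\<lambda>x. (dist p x)\<^sup>2)" and F_eq: "frechet_function Q p = ennreal (f p)" for p
    using frechet_function_eq_expectation[OF \<open>sets Q = sets borel\<close> finite_frechet[of p]]
    by (auto simp: f_def)
  have f_nonneg: "0 \<le> f p" for p unfolding f_def by simp
  have g: "katetov g"
    unfolding g_def f_def
    by (intro Q.katetov_L2_dist int) (simp add: measurable_cong_sets[OF \<open>sets Q = sets borel\<close> refl])
  have G: "katetov (G \<omega> n)" if "0 < n" for \<omega> n
    unfolding G_def by (rule katetov_sample_frechet[OF that])
  obtain p where p: "\<And>q. g p \<le> g q" using katetov_attains_min[OF heine_borel g] by blast
  \<comment> \<open>Squaring is monotone on nonnegative reals, so minimizers of \<open>g\<close> and \<open>G\<close> also minimize the
    Frechet functions.\<close>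
  have "frechet_variation Q = ennreal (f p)"
    using p unfolding F_eq[symmetric] by (intro frechet_variation_eqI) (simp add: F_eq g_def ennreal_leI)
  then have V: "enn2real (frechet_variation Q) = (g p)\<^sup>2" by (simp add: g_def f_nonneg)
  define r where "r \<omega> n = (SOME p. \<forall>q. G \<omega> n p \<le> G \<omega> n q)" for \<omega> n
  have r: "G \<omega> n (r \<omega> n) \<le> G \<omega> n q" if "0 < n" for \<omega> n q
    using someI_ex[OF katetov_attains_min[OF heine_borel G[OF that]]] unfolding r_def by blast
  have Vn: "sample_frechet_variation (\<lambda>j. X j \<omega>) n = (G \<omega> n (r \<omega> n))\<^sup>2" if "0 < n" for \<omega> n
  proof -
    have "0 \<le> sample_frechet_function (\<lambda>j. X j \<omega>) n q" for q
      by (simp add: sample_frechet_function_def sum_nonneg)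
    then show ?thesis
      using r[OF that, of \<omega>]
      by (subst sample_frechet_variation_eqI[of _ _ "r \<omega> n"]) (simp_all add: G_def)
  qed
  have slln: "AE \<omega> in P. (\<lambda>n. G \<omega> n q) \<longlonglongrightarrow> g q" for q
  proof -
    let ?Y = "\<lambda>j \<omega>. (dist q (X j \<omega>))\<^sup>2"
    have sq: "(\<lambda>x. (dist q x)\<^sup>2) \<in> borel_measurable borel" by measurable
    have mean: "P.expectation (?Y 0) = f q"
      unfolding f_def distr[of 0, symmetric] by (rule integral_distr[OF rv sq, symmetric])
    have "AE \<omega> in P. (\<lambda>n. (\<Sum>i<n. ?Y i \<omega>) / real n) \<longlonglongrightarrow> P.expectation (?Y 0)"
    proof (rule P.strong_law_of_large_numbers)
      show "P.indep_vars (\<lambda>_. borel) ?Y UNIV"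
        by (rule P.indep_vars_compose2[OF indep]) (rule sq)
      show "distr P borel (?Y i) = distr P borel (?Y 0)" for i
        by (rule distr_compose_cong[OF rv rv sq]) (simp add: distr)
      show "integrable P (?Y 0)"
        using int[of q] unfolding distr[of 0, symmetric] by (subst (asm) integrable_distr_eq[OF rv sq])
    qed
    then show ?thesis
      unfolding mean
    proof eventually_elim
      case (elim \<omega>)
      from tendsto_real_sqrt[OF elim] show ?case
        by (simp add: G_def g_def sample_frechet_function_def dist_commute)
    qed
  qed
  obtain D :: "'a set" where D: "countable D" "\<And>p e. 0 < e \<Longrightarrow> \<exists>q\<in>D. dist p q < e"
    using proper_space_separable[OF heine_borel] by blast
  have "AE \<omega> in P. \<forall>q\<in>D. (\<lambda>n. G \<omega> n q) \<longlonglongrightarrow> g q"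
    using slln by (simp add: AE_ball_countable[OF D(1)])
  then show ?thesis
  proof eventually_elim
    case (elim \<omega>)
    have ev: "\<forall>\<^sub>F n in sequentially. katetov (G \<omega> n)"
      using eventually_gt_at_top[of "0::nat"] by eventually_elim (rule G)
    have "(\<lambda>n. G \<omega> n (r \<omega> n)) \<longlonglongrightarrow> g p"
    proof (rule katetov_min_tendsto[where g = g and p = p and G = "G \<omega>" and r = "r \<omega>",
          OF heine_borel ev _ p])
      show "(\<lambda>n. G \<omega> n q) \<longlonglongrightarrow> g q" for q
        by (rule katetov_tendsto_of_dense[OF g ev D(2)]) (use elim in auto)
      show "\<forall>\<^sub>F n in sequentially. \<forall>q. G \<omega> n (r \<omega> n) \<le> G \<omega> n q"
        using eventually_gt_at_top[of "0::nat"] by eventually_elim (simp add: r)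
    qed
    then have "(\<lambda>n. (G \<omega> n (r \<omega> n))\<^sup>2) \<longlonglongrightarrow> enn2real (frechet_variation Q)"
      unfolding V by (rule tendsto_power)
    moreover have "\<forall>\<^sub>F n in sequentially. sample_frechet_variation (\<lambda>j. X j \<omega>) n = (G \<omega> n (r \<omega> n))\<^sup>2"
      using eventually_gt_at_top[of "0::nat"] by eventually_elim (rule Vn)
    ultimately show ?case by (rule tendsto_cong[THEN iffD2, rotated])
  qed
qed

end
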